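(* Let $A_1,\ldots,A_k$ be $n\times n$ complex Hermitian matrices whose spectra are contained in the real interval $J$, let $f$ be $g$-convex on $J$, and let $w_1,\ldots,w_k$ be positive scalars such that $\sum_{i=1}^k w_i=1$. Then $$\lambda\left(f\left(\sum_{i=1}^k w_iA_i\right)\right)\prec_w \lambda\left(g^{-1}\left(\sum_{i=1}^k w_i\,(g\circ f)(A_i)\right)\right)\prec_w \lambda\left(\sum_{i=1}^k w_i f(A_i)\right).$$
   Context: For an $n\times n$ Hermitian matrix $A$, $\lambda(A)=(\lambda_1(A),\dots,\lambda_n(A))$ is the vector of its eigenvalues, with multiplicity, in decreasing order. For vectors $x,y\in\mathbb{R}^n$ with decreasingly ordered entries, $x\prec_w y$ (weak majorization) means $\sum_{j=1}^{l}x_j\le\sum_{j=1}^{l}y_j$ for all $1\le l\le n$. Functions of Hermitian matrices are defined by functional calculus. Let $J,J_2,J_3\subseteq\mathbb{R}$ be intervals. A continuous function $f:J\to J_2$ is called $g$-convex on $J$ if $g:J_2\to J_3$ is (strictly) increasing and concave on $J_2$ and $g\circ f:J\to J_3$ is convex. $g^{-1}$ denotes the inverse of $g$, defined on $g(J_2)$. *)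

theory Defs
  imports "HOL-Analysis.Analysis" "Jordan_Normal_Form.Schur_Decomposition"
    "Jordan_Normal_Form.Spectral_Radius"
begin

definition hermitian_mat :: "nat \<Rightarrow> complex mat \<Rightarrow> bool" where
  "hermitian_mat n A \<longleftrightarrow> A \<in> carrier_mat n n \<and> mat_adjoint A = A"

definition unitary_mat :: "nat \<Rightarrow> complex mat \<Rightarrow> bool" where
  "unitary_mat n U \<longleftrightarrow> U \<in> carrier_mat n n \<and> mat_adjoint U * U = 1\<^sub>m n"

(* The roots of the characteristic polynomial are counted with multiplicity; for a Hermitian
   matrix they are all real, so passing to real parts loses nothing. *)
definition eigvals_desc :: "complex mat \<Rightarrow> real list" where
  "eigvals_desc A = rev (sorted_list_of_multiset (image_mset Re (proots (char_poly A))))"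

(* Meant for lists in decreasing order, such as those returned by eigvals_desc. List positions
   start at 0, so the sum ranges over the first l entries. *)
definition weak_majorized :: "real list \<Rightarrow> real list \<Rightarrow> bool" (infix \<open>\<prec>\<^sub>w\<close> 50) where
  "x \<prec>\<^sub>w y \<longleftrightarrow> length x = length y \<and>
     (\<forall>l\<in>{1..length x}. (\<Sum>j<l. x ! j) \<le> (\<Sum>j<l. y ! j))"

(* Functional calculus for a Hermitian A: if A = U diag(d) U* with U unitary and d real, then
   f(A) = U diag(f d) U*, which does not depend on the choice of U and d. Only the values of f
   on the spectrum of A matter. *)
definition mat_fun :: "(real \<Rightarrow> real) \<Rightarrow> complex mat \<Rightarrow> complex mat" where
  "mat_fun f A = (THE B. \<exists>U d. unitary_mat (dim_row A) U \<and>
     A = U * mat_diag (dim_row A) (\<lambda>i. complex_of_real (d i)) * mat_adjoint U \<and>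
     B = U * mat_diag (dim_row A) (\<lambda>i. complex_of_real (f (d i))) * mat_adjoint U)"

(* The n x n matrix w 1 A 1 + ... + w k A k; the type of matrices of all sizes has no zero, so
   the sum operator cannot be applied to it directly. *)
definition mat_wsum :: "nat \<Rightarrow> nat \<Rightarrow> (nat \<Rightarrow> real) \<Rightarrow> (nat \<Rightarrow> complex mat) \<Rightarrow> complex mat" where
  "mat_wsum n k w A = mat n n (\<lambda>(a, b). \<Sum>i=1..k. complex_of_real (w i) * A i $$ (a, b))"

definition g_convex ::
  "real set \<Rightarrow> real set \<Rightarrow> real set \<Rightarrow> (real \<Rightarrow> real) \<Rightarrow> (real \<Rightarrow> real) \<Rightarrow> bool" where
  "g_convex J J\<^sub>2 J\<^sub>3 g f \<longleftrightarrow>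
     f ` J \<subseteq> J\<^sub>2 \<and> continuous_on J f \<and>
     g ` J\<^sub>2 \<subseteq> J\<^sub>3 \<and> strict_mono_on J\<^sub>2 g \<and> concave_on J\<^sub>2 g \<and>
     convex_on J (g \<circ> f)"

end

theory Submission
  imports Defs
begin

text \<open>Let \<open>u\<^sub>1, \<dots>, u\<^sub>n\<close> be an orthonormal eigenbasis of a Hermitian \<open>X\<close>. By Ky Fan's maximum
  principle, \<open>\<lambda>(X) \<prec>\<^sub>w \<lambda>(M)\<close> for a Hermitian \<open>M\<close> as soon as every eigenvalue \<open>\<xi>\<^sub>j\<close> of \<open>X\<close> satisfies
  \<open>\<xi>\<^sub>j \<le> \<langle>M u\<^sub>j, u\<^sub>j\<rangle>\<close>. Both majorizations are obtained this way. For a unit vector \<open>u\<close> there are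
  weights \<open>q\<^sub>t\<close> of sum \<open>1\<close> and points \<open>x\<^sub>t\<close> of \<open>J\<close> such that \<open>\<langle>(\<Sum> w\<^sub>i \<phi>(A\<^sub>i)) u, u\<rangle> = \<Sum> q\<^sub>t \<phi>(x\<^sub>t)\<close>
  for all \<open>\<phi>\<close> at once, so that the required inequalities are Jensen's inequality for the convex
  \<open>g \<circ> f\<close>, the convex \<open>g\<inverse>\<close> and the concave \<open>g\<close>.\<close>

section \<open>Unitary matrices and functional calculus\<close>

lemma mat_adjoint_carrier [simp]: "A \<in> carrier_mat r c \<Longrightarrow> mat_adjoint A \<in> carrier_mat c r"
  unfolding mat_adjoint_def by (auto simp: mat_of_rows_def)

lemma dim_mat_adjoint [simp]: "dim_row (mat_adjoint A) = dim_col A" "dim_col (mat_adjoint A) = dim_row A"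
  unfolding mat_adjoint_def by (auto simp: mat_of_rows_def)

lemma index_mat_adjoint [simp]:
  fixes A :: "complex mat"
  assumes "i < dim_col A" "j < dim_row A"
  shows "mat_adjoint A $$ (i, j) = cnj (A $$ (j, i))"
  using assms unfolding mat_adjoint_def mat_of_rows_def by (simp add: col_def)

lemma mat_adjoint_adjoint [simp]: "mat_adjoint (mat_adjoint A) = (A :: complex mat)"
  by (rule eq_matI) auto

lemma index_mult_mat_sum:
  assumes "A \<in> carrier_mat r n" "B \<in> carrier_mat n c" "i < r" "j < c"
  shows "(A * B) $$ (i, j) = (\<Sum>l<n. A $$ (i, l) * B $$ (l, j))"
  using assms by (auto simp: scalar_prod_def atLeast0LessThan)

lemma mult_carrier_mat_square [simp]:
  "A \<in> carrier_mat n n \<Longrightarrow> B \<in> carrier_mat n n \<Longrightarrow> A * B \<in> carrier_mat n n"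
  by (rule mult_carrier_mat)

lemma mult_one_mat_square [simp]:
  fixes A :: "complex mat"
  shows "A \<in> carrier_mat n n \<Longrightarrow> 1\<^sub>m n * A = A" "A \<in> carrier_mat n n \<Longrightarrow> A * 1\<^sub>m n = A"
  by (auto intro: left_mult_one_mat right_mult_one_mat)

lemma mat_adjoint_mult:
  fixes A B :: "complex mat"
  assumes "A \<in> carrier_mat r n" "B \<in> carrier_mat n c"
  shows "mat_adjoint (A * B) = mat_adjoint B * mat_adjoint A"
proof (rule eq_matI)
  fix i j assume "i < dim_row (mat_adjoint B * mat_adjoint A)" "j < dim_col (mat_adjoint B * mat_adjoint A)"
  with assms have ij: "i < c" "j < r" by auto
  have "mat_adjoint (A * B) $$ (i, j) = cnj ((A * B) $$ (j, i))"
    using assms ij by (intro index_mat_adjoint) auto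
  also have "\<dots> = (\<Sum>l<n. mat_adjoint B $$ (i, l) * mat_adjoint A $$ (l, j))"
    using ij carrier_matD[OF assms(1)] carrier_matD[OF assms(2)]
    unfolding index_mult_mat_sum[OF assms ij(2,1)] by (auto simp: mult.commute intro!: sum.cong)
  also have "\<dots> = (mat_adjoint B * mat_adjoint A) $$ (i, j)"
    using assms ij by (intro index_mult_mat_sum[symmetric]) auto
  finally show "mat_adjoint (A * B) $$ (i, j) = (mat_adjoint B * mat_adjoint A) $$ (i, j)" .
qed (use assms in auto)

lemma unitary_mat_carrier: "unitary_mat n U \<Longrightarrow> U \<in> carrier_mat n n"
  by (simp add: unitary_mat_def)

lemma unitary_mat_left: "unitary_mat n U \<Longrightarrow> mat_adjoint U * U = 1\<^sub>m n"
  by (simp add: unitary_mat_def)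

text \<open>For square matrices a one-sided inverse is two-sided.\<close>

lemma unitary_mat_right: "unitary_mat n U \<Longrightarrow> U * mat_adjoint U = 1\<^sub>m n"
  using mat_mult_left_right_inverse[of "mat_adjoint U" n U] by (simp add: unitary_mat_def)

lemma unitary_mat_adjoint: "unitary_mat n U \<Longrightarrow> unitary_mat n (mat_adjoint U)"
  using unitary_mat_right[of n U] by (simp add: unitary_mat_def)

lemma unitary_mat_mult:
  assumes U: "unitary_mat n U" and V: "unitary_mat n V"
  shows "unitary_mat n (U * V)"
proof -
  note c [simp] = unitary_mat_carrier[OF U] unitary_mat_carrier[OF V]
  have "mat_adjoint (U * V) * (U * V) = mat_adjoint V * mat_adjoint U * (U * V)"
    by (simp add: mat_adjoint_mult[OF c])
  also have "\<dots> = mat_adjoint V * (mat_adjoint U * (U * V))"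
    by (rule assoc_mult_mat[of _ n n _ n _ n]) auto
  also have "mat_adjoint U * (U * V) = mat_adjoint U * U * V"
    by (rule assoc_mult_mat[symmetric, of _ n n _ n _ n]) auto
  also have "mat_adjoint V * \<dots> = 1\<^sub>m n"
    by (simp add: unitary_mat_left[OF U] unitary_mat_left[OF V])
  finally show ?thesis by (simp add: unitary_mat_def)
qed

lemma unitary_mat_col_norm:
  assumes U: "unitary_mat n U" and j: "j < n"
  shows "(\<Sum>i<n. (cmod (U $$ (i, j)))\<^sup>2) = 1"
proof -
  note c [simp] = unitary_mat_carrier[OF U]
  have "complex_of_real (\<Sum>i<n. (cmod (U $$ (i, j)))\<^sup>2) = (\<Sum>i<n. cnj (U $$ (i, j)) * U $$ (i, j))"
    unfolding of_real_sum by (intro sum.cong refl) (metis complex_norm_square mult.commute)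
  also have "\<dots> = (\<Sum>i<n. mat_adjoint U $$ (j, i) * U $$ (i, j))"
    using j carrier_matD[OF c] by (intro sum.cong refl) auto
  also have "\<dots> = (mat_adjoint U * U) $$ (j, j)"
    using j by (intro index_mult_mat_sum[symmetric]) auto
  also have "\<dots> = 1" using j unitary_mat_left[OF U] by simp
  finally show ?thesis by (simp only: of_real_eq_1_iff)
qed

lemma unitary_mat_row_norm:
  assumes U: "unitary_mat n U" and i: "i < n"
  shows "(\<Sum>j<n. (cmod (U $$ (i, j)))\<^sup>2) = 1"
proof -
  have "(\<Sum>j<n. (cmod (U $$ (i, j)))\<^sup>2) = (\<Sum>j<n. (cmod (mat_adjoint U $$ (j, i)))\<^sup>2)"
    using i unitary_mat_carrier[OF U] by (intro sum.cong refl) auto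
  also have "\<dots> = 1" by (rule unitary_mat_col_norm[OF unitary_mat_adjoint[OF U] i])
  finally show ?thesis .
qed

text \<open>The shape over which \<open>mat_fun\<close> quantifies. A Hermitian matrix is handled as
  a pair of a unitary \<open>U\<close>, whose columns are eigenvectors, and real eigenvalues
  \<open>d\<close>, so that the functional calculus only touches \<open>d\<close>.\<close>

definition conj_diag :: "nat \<Rightarrow> complex mat \<Rightarrow> (nat \<Rightarrow> real) \<Rightarrow> complex mat" where
  "conj_diag n U d = U * mat_diag n (\<lambda>i. complex_of_real (d i)) * mat_adjoint U"

lemma conj_diag_carrier [simp]: "U \<in> carrier_mat n n \<Longrightarrow> conj_diag n U d \<in> carrier_mat n n"
  unfolding conj_diag_def by (meson mat_adjoint_carrier mat_diag_dim mult_carrier_mat)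

lemma index_conj_diag:
  assumes U: "U \<in> carrier_mat n n" and "i < n" "j < n"
  shows "conj_diag n U d $$ (i, j) = (\<Sum>l<n. U $$ (i, l) * of_real (d l) * cnj (U $$ (j, l)))"
proof -
  have "conj_diag n U d $$ (i, j) =
      (\<Sum>l<n. (U * mat_diag n (\<lambda>i. complex_of_real (d i))) $$ (i, l) * mat_adjoint U $$ (l, j))"
    unfolding conj_diag_def using assms by (intro index_mult_mat_sum) auto
  also have "\<dots> = (\<Sum>l<n. U $$ (i, l) * of_real (d l) * cnj (U $$ (j, l)))"
    using assms by (intro sum.cong refl) (auto simp: mat_diag_mult_right[OF U])
  finally show ?thesis .
qed

lemma hermitian_conj_diag:
  assumes "U \<in> carrier_mat n n"
  shows "hermitian_mat n (conj_diag n U d)"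
proof -
  have "mat_adjoint (conj_diag n U d) = conj_diag n U d"
  proof (rule eq_matI)
    fix i j assume "i < dim_row (conj_diag n U d)" "j < dim_col (conj_diag n U d)"
    then have ij: "i < n" "j < n" using carrier_matD[OF conj_diag_carrier[OF assms, of d]] by auto
    have "mat_adjoint (conj_diag n U d) $$ (i, j) = cnj (conj_diag n U d $$ (j, i))"
      using ij carrier_matD[OF conj_diag_carrier[OF assms, of d]] by (intro index_mat_adjoint) auto
    then show "mat_adjoint (conj_diag n U d) $$ (i, j) = conj_diag n U d $$ (i, j)"
      using ij by (simp add: index_conj_diag[OF assms] mult.commute mult.left_commute)
  qed (use carrier_matD[OF conj_diag_carrier[OF assms, of d]] in auto)
  then show ?thesis by (simp add: hermitian_mat_def assms)
qed

lemma hermitian_mat_wsum: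
  assumes "\<And>i. i \<in> {1..k} \<Longrightarrow> hermitian_mat n (A i)"
  shows "hermitian_mat n (mat_wsum n k w A)"
proof -
  have "cnj (A i $$ (b, a)) = A i $$ (a, b)" if "i \<in> {1..k}" "a < n" "b < n" for i a b
    using assms[OF that(1)] that index_mat_adjoint[of a "A i" b] by (auto simp: hermitian_mat_def)
  then have "mat_adjoint (mat_wsum n k w A) = mat_wsum n k w A"
    unfolding mat_wsum_def by (intro eq_matI) (auto intro!: sum.cong)
  then show ?thesis by (simp add: hermitian_mat_def mat_wsum_def)
qed

lemma conj_diag_mult_right:
  assumes U: "unitary_mat n U"
  shows "conj_diag n U d * U = U * mat_diag n (\<lambda>i. complex_of_real (d i))"
proof -
  note c [simp] = unitary_mat_carrier[OF U]
  have "conj_diag n U d * U = U * mat_diag n (\<lambda>i. complex_of_real (d i)) * (mat_adjoint U * U)"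
    unfolding conj_diag_def by (rule assoc_mult_mat[of _ n n _ n _ n]) auto
  then show ?thesis
    by (simp add: unitary_mat_left[OF U])
qed

lemma mat_eqI_mult_unitary:
  assumes U: "unitary_mat n U" and "A \<in> carrier_mat n n" "B \<in> carrier_mat n n" and "A * U = B * U"
  shows "A = B"
proof -
  note c [simp] = unitary_mat_carrier[OF U]
  have *: "X * U * mat_adjoint U = X" if X: "X \<in> carrier_mat n n" for X
  proof -
    have "X * U * mat_adjoint U = X * (U * mat_adjoint U)"
      by (rule assoc_mult_mat[OF X c, of _ n]) simp
    then show ?thesis unfolding unitary_mat_right[OF U] mult_one_mat_square(2)[OF X] .
  qed
  have "A = B * U * mat_adjoint U" unfolding assms(4)[symmetric] by (rule *[symmetric]) fact
  also have "\<dots> = B" by (rule *) fact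
  finally show ?thesis .
qed

text \<open>The entry at \<open>(i, j)\<close> of \<open>V\<^sup>* U\<close> vanishes unless \<open>d j = e i\<close>, so it intertwines
  the diagonal matrices also after applying \<open>f\<close>.\<close>

lemma conj_diag_fun_cong:
  assumes U: "unitary_mat n U" and V: "unitary_mat n V"
    and eq: "conj_diag n U d = conj_diag n V e"
  shows "conj_diag n U (\<lambda>i. f (d i)) = conj_diag n V (\<lambda>i. f (e i))"
proof -
  note cU [simp] = unitary_mat_carrier[OF U] and cV [simp] = unitary_mat_carrier[OF V]
  define S where "S = mat_adjoint V * U"
  have cS [simp]: "S \<in> carrier_mat n n" unfolding S_def by (rule mult_carrier_mat[of _ n n]) auto
  have VS: "V * S = U"
    unfolding S_def using assoc_mult_mat[OF cV mat_adjoint_carrier[OF cV] cU]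
    by (simp add: unitary_mat_right[OF V])
  let ?D = "\<lambda>d. mat_diag n (\<lambda>i. complex_of_real (d i))"
  \<comment> \<open>\<open>S\<close> is the change of basis between the two eigenbases. The
    identities \<open>e1\<close> and \<open>e2\<close> hold for arbitrary diagonals, so they serve
    first for \<open>d\<close> and \<open>e\<close> and again after \<open>f\<close> has been
    applied.\<close>
  have e1: "conj_diag n V e * U = V * (?D e * S)" for e
  proof -
    have "conj_diag n V e * U = conj_diag n V e * V * S"
      unfolding VS[symmetric] by (rule assoc_mult_mat[symmetric, of _ n n _ n _ n]) auto
    also have "\<dots> = V * (?D e * S)"
      unfolding conj_diag_mult_right[OF V] by (rule assoc_mult_mat[of _ n n _ n _ n]) auto
    finally show ?thesis .
  qed
  have e2: "conj_diag n U d * U = V * (S * ?D d)" for d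
  proof -
    have "conj_diag n U d * U = V * S * ?D d" unfolding conj_diag_mult_right[OF U] VS ..
    also have "\<dots> = V * (S * ?D d)" by (rule assoc_mult_mat[of _ n n _ n _ n]) auto
    finally show ?thesis .
  qed
  have cancel: "mat_adjoint V * (V * X) = X" if "X \<in> carrier_mat n n" for X
    using assoc_mult_mat[OF mat_adjoint_carrier[OF cV] cV that] that by (simp add: unitary_mat_left[OF V])
  have "?D e * S = mat_adjoint V * (V * (?D e * S))" by (rule cancel[symmetric]) simp
  also have "V * (?D e * S) = V * (S * ?D d)" by (simp only: e1[symmetric] e2[symmetric] eq)
  also have "mat_adjoint V * \<dots> = S * ?D d" by (rule cancel) simp
  finally have DS: "?D e * S = S * ?D d" .
  have entry: "S $$ (i, j) = 0 \<or> e i = d j" if "i < n" "j < n" for i j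
    using that arg_cong[OF DS, of "\<lambda>M. M $$ (i, j)"]
    by (simp add: mat_diag_mult_left[OF cS] mat_diag_mult_right[OF cS])
  have "?D (\<lambda>i. f (e i)) * S = S * ?D (\<lambda>i. f (d i))"
    unfolding mat_diag_mult_left[OF cS] mat_diag_mult_right[OF cS]
  proof (rule cong_mat)
    fix i j assume "i < n" "j < n"
    from entry[OF this] show "(case (i, j) of (i, j) \<Rightarrow> complex_of_real (f (e i)) * S $$ (i, j)) =
        (case (i, j) of (i, j) \<Rightarrow> S $$ (i, j) * complex_of_real (f (d j)))"
      by auto
  qed simp_all
  then have *: "conj_diag n U (\<lambda>i. f (d i)) * U = conj_diag n V (\<lambda>i. f (e i)) * U"
    by (simp only: e1 e2)
  show ?thesis by (rule mat_eqI_mult_unitary[OF U _ _ *]) auto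
qed

text \<open>By \<open>conj_diag_fun_cong\<close> all diagonalizations of one matrix yield the same
  result, which is the uniqueness that the \<open>THE\<close> in \<open>mat_fun\<close>
  requires.\<close>

lemma mat_fun_conj_diag:
  assumes U: "unitary_mat n U"
  shows "mat_fun f (conj_diag n U d) = conj_diag n U (\<lambda>i. f (d i))"
proof -
  have dim: "dim_row (conj_diag n U d) = n"
    using conj_diag_carrier[OF unitary_mat_carrier[OF U], of d] by auto
  show ?thesis
    unfolding mat_fun_def dim
    unfolding conj_diag_def[symmetric]
  proof (rule the_equality)
    show "\<exists>V e. unitary_mat n V \<and> conj_diag n U d = conj_diag n V e \<and>
        conj_diag n U (\<lambda>i. f (d i)) = conj_diag n V (\<lambda>i. f (e i))"
      using U by blast
  next
    fix B assume "\<exists>V e. unitary_mat n V \<and> conj_diag n U d = conj_diag n V e \<and>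
        B = conj_diag n V (\<lambda>i. f (e i))"
    then show "B = conj_diag n U (\<lambda>i. f (d i))"
      using conj_diag_fun_cong[OF U] by metis
  qed
qed

section \<open>Eigenvalues read off from a diagonalization\<close>

lemma char_poly_conj_diag:
  assumes U: "unitary_mat n U"
  shows "char_poly (conj_diag n U d) = (\<Prod>x\<leftarrow>map d [0..<n]. [:- complex_of_real x, 1:])"
proof -
  note c [simp] = unitary_mat_carrier[OF U]
  let ?D = "mat_diag n (\<lambda>i. complex_of_real (d i))"
  have "similar_mat (conj_diag n U d) ?D"
    by (rule similar_matI[of _ _ U "mat_adjoint U" n])
       (auto simp: unitary_mat_left[OF U] unitary_mat_right[OF U] conj_diag_def[symmetric])
  then have "char_poly (conj_diag n U d) = char_poly ?D" by (rule char_poly_similar)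
  also have "\<dots> = (\<Prod>x\<leftarrow>diag_mat ?D. [:- x, 1:])"
    by (rule char_poly_upper_triangular[of _ n]) (auto simp: mat_diag_def)
  also have "diag_mat ?D = map (\<lambda>i. complex_of_real (d i)) [0..<n]"
    by (auto simp: diag_mat_def mat_diag_def)
  finally show ?thesis by (simp add: o_def)
qed

lemma proots_prod_list_linear:
  "proots (\<Prod>x\<leftarrow>xs. [:- f x, 1:]) = image_mset f (mset xs)" for f :: "'b \<Rightarrow> 'a :: idom"
proof (induction xs)
  case (Cons x xs)
  have "(\<Prod>x\<leftarrow>xs. [:- f x, 1:]) \<noteq> 0" by auto
  then have "proots (\<Prod>x\<leftarrow>x # xs. [:- f x, 1:]) = proots [:- f x, 1:] + proots (\<Prod>x\<leftarrow>xs. [:- f x, 1:])"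
    unfolding list.map prod_list.Cons by (intro proots_mult) auto
  then show ?case using Cons by simp
qed simp

lemma eigvals_desc_conj_diag:
  assumes U: "unitary_mat n U"
  shows "eigvals_desc (conj_diag n U d) = rev (sort (map d [0..<n]))"
proof -
  have "image_mset Re (proots (char_poly (conj_diag n U d))) = mset (map d [0..<n])"
    unfolding char_poly_conj_diag[OF U] proots_prod_list_linear
    by (simp add: image_mset.compositionality o_def)
  then show ?thesis unfolding eigvals_desc_def by (simp only: sorted_list_of_multiset_mset)
qed

lemma spectrum_conj_diag:
  assumes U: "unitary_mat n U"
  shows "spectrum (conj_diag n U d) = complex_of_real ` d ` {..<n}"
proof -
  have "x \<in> spectrum (conj_diag n U d) \<longleftrightarrow> (\<exists>i<n. x = complex_of_real (d i))" for x
    unfolding spectrum_root_char_poly[OF conj_diag_carrier[OF unitary_mat_carrier[OF U]]]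
      char_poly_conj_diag[OF U] mem_Collect_eq poly_prod_list prod_list_zero_iff
    by auto
  then show ?thesis by blast
qed

section \<open>The spectral theorem\<close>

text \<open>An eigenvector exists over the complex numbers. It is completed to a basis, and
  Gram-Schmidt leaves the first basis vector alone, so after normalization the eigenvector is column
  0 of \<open>W\<close>.\<close>

lemma unitary_mat_eigenvector_col:
  fixes A :: "complex mat"
  assumes A: "A \<in> carrier_mat n n" and n: "n > 0"
  obtains W e where "unitary_mat n W" "\<And>i. i < n \<Longrightarrow> (A * W) $$ (i, 0) = e * W $$ (i, 0)"
proof -
  obtain e v where v: "v \<in> carrier_vec n" "v \<noteq> 0\<^sub>v n" and Av: "A *\<^sub>v v = e \<cdot>\<^sub>v v"
    using spectrum_non_empty[OF A n] A unfolding spectrum_def eigenvalue_def eigenvector_def by auto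
  interpret cof_vec_space n "TYPE(complex)" .
  define b where "b = basis_completion v"
  define ws where "ws = gram_schmidt n b"
  note bc = basis_completion[OF v, folded b_def]
  have ws: "corthogonal ws" "set ws \<subseteq> carrier_vec n" "length ws = n"
    using gram_schmidt_result[OF bc(2,4,5) ws_def] bc(6) by auto
  have "b = v # tl b" using bc(6,7) n by (cases b) auto
  then have "hd ws = v" unfolding ws_def by (metis gram_schmidt_hd v(1))
  then have ws0: "ws ! 0 = v" using ws(3) n by (simp add: hd_conv_nth[symmetric] flip: length_greater_0_conv)
  have wsc: "ws ! j \<in> carrier_vec n" if "j < n" for j using ws(2,3) that by auto
  \<comment> \<open>\<open>gram_schmidt\<close> returns orthogonal vectors of arbitrary length. The
    squared lengths \<open>r j\<close> are nonzero because \<open>corthogonal\<close> excludes zero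
    vectors.\<close>
  define r where "r j = (\<Sum>l<n. (cmod (ws ! j $ l))\<^sup>2)" for j
  have sp: "ws ! j \<bullet>c ws ! i = (\<Sum>l<n. ws ! j $ l * cnj (ws ! i $ l))" if "i < n" "j < n" for i j
    using carrier_vecD[OF wsc[OF that(1)]] carrier_vecD[OF wsc[OF that(2)]]
    by (simp add: scalar_prod_def atLeast0LessThan)
  have spr: "(\<Sum>l<n. ws ! j $ l * cnj (ws ! j $ l)) = of_real (r j)" if "j < n" for j
    unfolding r_def of_real_sum by (intro sum.cong refl) (metis complex_norm_square of_real_power)
  have r: "r j > 0" if "j < n" for j
  proof -
    have "r j \<noteq> 0"
      using corthogonalD[OF ws(1), of j j] that ws(3) sp[of j j] spr[of j] by auto
    moreover have "r j \<ge> 0" unfolding r_def by (intro sum_nonneg) auto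
    ultimately show ?thesis by simp
  qed
  define W where "W = mat n n (\<lambda>(i, j). ws ! j $ i / of_real (sqrt (r j)))"
  have W [simp]: "W \<in> carrier_mat n n" by (simp add: W_def)
  have "mat_adjoint W * W = 1\<^sub>m n"
  proof (rule eq_matI)
    fix i j assume "i < dim_row (1\<^sub>m n :: complex mat)" "j < dim_col (1\<^sub>m n :: complex mat)"
    then have ij: "i < n" "j < n" by auto
    have "(mat_adjoint W * W) $$ (i, j) = (\<Sum>l<n. mat_adjoint W $$ (i, l) * W $$ (l, j))"
      using ij by (intro index_mult_mat_sum) auto
    also have "\<dots> = (\<Sum>l<n. ws ! j $ l * cnj (ws ! i $ l) / of_real (sqrt (r i) * sqrt (r j)))"
      using ij carrier_matD[OF W] by (intro sum.cong refl) (simp add: W_def)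
    also have "\<dots> = (ws ! j \<bullet>c ws ! i) / of_real (sqrt (r i) * sqrt (r j))"
      unfolding sp[OF ij] by (simp only: sum_divide_distrib)
    also have "\<dots> = (if i = j then 1 else 0)"
    proof (cases "i = j")
      case True
      then show ?thesis using ij r[of j] by (simp add: sp spr real_sqrt_mult_self flip: of_real_mult)
    next
      case False
      then show ?thesis using corthogonalD[OF ws(1), of j i] ij ws(3) by simp
    qed
    finally show "(mat_adjoint W * W) $$ (i, j) = 1\<^sub>m n $$ (i, j)" using ij by simp
  qed (use carrier_matD[OF W] in auto)
  then have U: "unitary_mat n W" by (simp add: unitary_mat_def)
  have "(A * W) $$ (i, 0) = e * W $$ (i, 0)" if i: "i < n" for i
  proof -
    have "(A * W) $$ (i, 0) = (\<Sum>l<n. A $$ (i, l) * W $$ (l, 0))"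
      using i n A W by (intro index_mult_mat_sum[of _ n n _ n]) auto
    also have "\<dots> = (\<Sum>l<n. A $$ (i, l) * v $ l) / of_real (sqrt (r 0))"
      unfolding sum_divide_distrib using n ws0 by (intro sum.cong refl) (simp add: W_def)
    also have "(\<Sum>l<n. A $$ (i, l) * v $ l) = (A *\<^sub>v v) $ i"
      using i A v(1) by (simp add: scalar_prod_def atLeast0LessThan)
    also have "\<dots> = e * v $ i" using i v(1) unfolding Av by simp
    finally show ?thesis using i n ws0 by (simp add: W_def)
  qed
  then show thesis by (rule that[OF U])
qed

lemma hermitian_mat_index:
  assumes "hermitian_mat n A" "i < n" "j < n"
  shows "cnj (A $$ (i, j)) = A $$ (j, i)"
  using assms index_mat_adjoint[of j A i] by (auto simp: hermitian_mat_def)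

text \<open>Induction on the size: in an orthonormal basis that starts with an eigenvector, the
  matrix splits into the eigenvalue and a smaller Hermitian block.\<close>

lemma hermitian_mat_diagonalize:
  assumes "hermitian_mat n A"
  obtains U d where "unitary_mat n U" "A = conj_diag n U d"
proof -
  have "\<exists>U d. unitary_mat n U \<and> A = conj_diag n U d"
    using assms
  proof (induction n arbitrary: A)
    case 0
    then have "unitary_mat 0 (1\<^sub>m 0)" "A = conj_diag 0 (1\<^sub>m 0) (\<lambda>_. 0)"
      by (auto simp: unitary_mat_def hermitian_mat_def conj_diag_def mat_diag_def intro!: eq_matI)
    then show ?case by blast
  next
    case (Suc m)
    let ?n = "Suc m"
    from Suc.prems have A [simp]: "A \<in> carrier_mat ?n ?n" and adjA: "mat_adjoint A = A"
      by (auto simp: hermitian_mat_def)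
    obtain W e where W: "unitary_mat ?n W"
      and ev: "\<And>i. i < ?n \<Longrightarrow> (A * W) $$ (i, 0) = e * W $$ (i, 0)"
      by (rule unitary_mat_eigenvector_col[OF A]) auto
    note cW [simp] = unitary_mat_carrier[OF W]
    have cW' [simp]: "mat_adjoint W \<in> carrier_mat ?n ?n" by simp
    define B where "B = mat_adjoint W * (A * W)"
    have cB [simp]: "B \<in> carrier_mat ?n ?n" unfolding B_def by simp
    have "mat_adjoint B = mat_adjoint (A * W) * mat_adjoint (mat_adjoint W)"
      unfolding B_def by (rule mat_adjoint_mult[of _ ?n ?n _ ?n]) auto
    also have "mat_adjoint (A * W) = mat_adjoint W * A"
      using mat_adjoint_mult[OF A cW] by (simp add: adjA)
    also have "mat_adjoint W * A * mat_adjoint (mat_adjoint W) = B"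
      unfolding B_def mat_adjoint_adjoint by (rule assoc_mult_mat[OF cW' A cW])
    finally have herm: "hermitian_mat ?n B" by (simp add: hermitian_mat_def)
    have B0: "B $$ (i, 0) = (if i = 0 then e else 0)" if i: "i < ?n" for i
    proof -
      have "B $$ (i, 0) = (\<Sum>l<?n. mat_adjoint W $$ (i, l) * (A * W) $$ (l, 0))"
        unfolding B_def using i by (intro index_mult_mat_sum[of _ ?n ?n _ ?n]) auto
      also have "\<dots> = e * (\<Sum>l<?n. mat_adjoint W $$ (i, l) * W $$ (l, 0))"
        unfolding sum_distrib_left using ev by (intro sum.cong refl) auto
      also have "(\<Sum>l<?n. mat_adjoint W $$ (i, l) * W $$ (l, 0)) = (mat_adjoint W * W) $$ (i, 0)"
        using i by (intro index_mult_mat_sum[symmetric, of _ ?n ?n _ ?n]) auto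
      finally show ?thesis using i by (simp add: unitary_mat_left[OF W])
    qed
    \<comment> \<open>Hermitian symmetry transfers the zeros of column 0 to row 0. It also makes the
      eigenvalue \<open>e\<close> real.\<close>
    have B0': "B $$ (0, i) = (if i = 0 then e else 0)" if i: "i < ?n" for i
      using hermitian_mat_index[OF herm, of i 0] hermitian_mat_index[OF herm, of 0 0] B0[OF i] B0[of 0] i
      by (auto split: if_splits)
    have "cnj e = e" using hermitian_mat_index[OF herm, of 0 0] B0[of 0] by simp
    then have e: "of_real (Re e) = e" by (simp add: complex_eq_iff)
    define C where "C = mat m m (\<lambda>(i, j). B $$ (Suc i, Suc j))"
    have "mat_adjoint C = C"
      by (rule eq_matI) (auto simp: C_def hermitian_mat_index[OF herm])
    then have "hermitian_mat m C" by (simp add: hermitian_mat_def C_def)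
    from Suc.IH[OF this] obtain V d where V: "unitary_mat m V" and C: "C = conj_diag m V d" by blast
    note cV [simp] = unitary_mat_carrier[OF V]
    \<comment> \<open>The block diagonal matrix with blocks 1 and \<open>V\<close>. It goes with the
      eigenvalue list \<open>case_nat (Re e) d\<close>, in which \<open>e\<close> precedes the
      eigenvalues of the smaller block.\<close>
    define X where "X = mat ?n ?n (\<lambda>(i, j). case (i, j) of (Suc i, Suc j) \<Rightarrow> V $$ (i, j)
      | (0, 0) \<Rightarrow> 1 | _ \<Rightarrow> 0)"
    have cX [simp]: "X \<in> carrier_mat ?n ?n" by (simp add: X_def)
    have X: "X $$ (0, 0) = 1" "\<And>i. i < m \<Longrightarrow> X $$ (Suc i, 0) = 0" "\<And>i. i < m \<Longrightarrow> X $$ (0, Suc i) = 0"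
      "\<And>i j. i < m \<Longrightarrow> j < m \<Longrightarrow> X $$ (Suc i, Suc j) = V $$ (i, j)"
      by (simp_all add: X_def)
    have VV: "(\<Sum>l<m. cnj (V $$ (l, i)) * V $$ (l, j)) = (if i = j then 1 else 0)" if "i < m" "j < m" for i j
    proof -
      have "(\<Sum>l<m. cnj (V $$ (l, i)) * V $$ (l, j)) = (\<Sum>l<m. mat_adjoint V $$ (i, l) * V $$ (l, j))"
        using that carrier_matD[OF cV] by (intro sum.cong refl) simp
      also have "\<dots> = (mat_adjoint V * V) $$ (i, j)"
        using that by (intro index_mult_mat_sum[symmetric]) auto
      finally show ?thesis using that by (simp add: unitary_mat_left[OF V])
    qed
    have "mat_adjoint X * X = 1\<^sub>m ?n"
    proof (rule eq_matI)
      fix i j assume "i < dim_row (1\<^sub>m ?n :: complex mat)" "j < dim_col (1\<^sub>m ?n :: complex mat)"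
      then have ij: "i < ?n" "j < ?n" by auto
      have "(mat_adjoint X * X) $$ (i, j) = (\<Sum>l<?n. mat_adjoint X $$ (i, l) * X $$ (l, j))"
        using ij by (intro index_mult_mat_sum) auto
      also have "\<dots> = (\<Sum>l<?n. cnj (X $$ (l, i)) * X $$ (l, j))"
        using ij carrier_matD[OF cX] by (intro sum.cong refl) simp
      also have "\<dots> = (if i = j then 1 else 0)"
        using ij by (cases i; cases j) (simp_all add: sum.lessThan_Suc_shift X VV del: sum.lessThan_Suc)
      finally show "(mat_adjoint X * X) $$ (i, j) = 1\<^sub>m ?n $$ (i, j)" using ij by simp
    qed (use carrier_matD[OF cX] in auto)
    then have uX: "unitary_mat ?n X" by (simp add: unitary_mat_def)
    have CB: "(\<Sum>l<m. V $$ (i, l) * of_real (d l) * cnj (V $$ (j, l))) = B $$ (Suc i, Suc j)"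
      if "i < m" "j < m" for i j
      using that arg_cong[OF C, of "\<lambda>M. M $$ (i, j)"] by (simp add: index_conj_diag C_def)
    have B: "B = conj_diag ?n X (case_nat (Re e) d)"
    proof (rule eq_matI)
      fix i j assume "i < dim_row (conj_diag ?n X (case_nat (Re e) d))"
        "j < dim_col (conj_diag ?n X (case_nat (Re e) d))"
      then have ij: "i < ?n" "j < ?n"
        using carrier_matD[OF conj_diag_carrier[OF cX, of "case_nat (Re e) d"]] by auto
      then show "B $$ (i, j) = conj_diag ?n X (case_nat (Re e) d) $$ (i, j)"
        by (cases i; cases j)
          (simp_all add: index_conj_diag sum.lessThan_Suc_shift X CB e B0 B0' del: sum.lessThan_Suc)
    qed (use carrier_matD[OF cB] carrier_matD[OF conj_diag_carrier[OF cX, of "case_nat (Re e) d"]] in auto)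
    have "A = W * B * mat_adjoint W"
    proof -
      have "W * B = W * mat_adjoint W * (A * W)"
        unfolding B_def by (rule assoc_mult_mat[symmetric, of _ ?n ?n _ ?n _ ?n]) auto
      then have "W * B * mat_adjoint W = A * W * mat_adjoint W" by (simp add: unitary_mat_right[OF W])
      also have "\<dots> = A * (W * mat_adjoint W)" by (rule assoc_mult_mat[OF A cW cW'])
      finally show ?thesis by (simp add: unitary_mat_right[OF W])
    qed
    also have "\<dots> = conj_diag ?n (W * X) (case_nat (Re e) d)"
    proof -
      let ?D = "mat_diag ?n (\<lambda>i. complex_of_real (case_nat (Re e) d i))"
      have "W * B * mat_adjoint W = W * (X * ?D) * mat_adjoint X * mat_adjoint W"
        unfolding B conj_diag_def by (subst assoc_mult_mat[of W ?n ?n "X * ?D" ?n _ ?n]) auto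
      also have "W * (X * ?D) = W * X * ?D" by (rule assoc_mult_mat[symmetric, of _ ?n ?n _ ?n _ ?n]) auto
      also have "W * X * ?D * mat_adjoint X * mat_adjoint W = W * X * ?D * (mat_adjoint X * mat_adjoint W)"
        by (rule assoc_mult_mat[of _ ?n ?n _ ?n _ ?n]) auto
      finally show ?thesis by (simp add: conj_diag_def mat_adjoint_mult[OF cW cX])
    qed
    finally show ?case using unitary_mat_mult[OF W uX] by blast
  qed
  then show thesis using that by blast
qed

section \<open>Ky Fan's maximum principle\<close>

text \<open>The quadratic form of \<open>M\<close> at column \<open>j\<close> of \<open>U\<close>.
  For Hermitian \<open>M\<close> it is real, so \<open>Re\<close> loses nothing.\<close>

definition diag_entry :: "complex mat \<Rightarrow> complex mat \<Rightarrow> nat \<Rightarrow> real" where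
  "diag_entry U M j = Re ((mat_adjoint U * M * U) $$ (j, j))"

text \<open>The squared modulus of the inner product of column \<open>j\<close> of \<open>U\<close>
  with column \<open>m\<close> of \<open>V\<close>. For unitary \<open>U\<close> and
  \<open>V\<close> these numbers form a doubly stochastic matrix.\<close>

definition overlap :: "complex mat \<Rightarrow> complex mat \<Rightarrow> nat \<Rightarrow> nat \<Rightarrow> real" where
  "overlap U V j m = (cmod ((mat_adjoint U * V) $$ (j, m)))\<^sup>2"

lemma overlap_nonneg: "overlap U V j m \<ge> 0"
  by (simp add: overlap_def)

lemma overlap_row_sum:
  assumes "unitary_mat n U" "unitary_mat n V" "j < n"
  shows "(\<Sum>m<n. overlap U V j m) = 1"
  unfolding overlap_def
  by (intro unitary_mat_row_norm unitary_mat_mult unitary_mat_adjoint assms)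

lemma overlap_col_sum:
  assumes "unitary_mat n U" "unitary_mat n V" "m < n"
  shows "(\<Sum>j<n. overlap U V j m) = 1"
  unfolding overlap_def
  by (intro unitary_mat_col_norm unitary_mat_mult unitary_mat_adjoint assms)

lemma conj_conj_diag:
  assumes U: "U \<in> carrier_mat n n" and V: "V \<in> carrier_mat n n"
  shows "mat_adjoint U * conj_diag n V d * U = conj_diag n (mat_adjoint U * V) d"
proof -
  note [simp] = U V
  let ?D = "mat_diag n (\<lambda>i. complex_of_real (d i))"
  have "mat_adjoint U * conj_diag n V d * U = mat_adjoint U * (V * ?D) * mat_adjoint V * U"
    unfolding conj_diag_def by (subst assoc_mult_mat[of "mat_adjoint U" n n "V * ?D" n _ n]) auto
  also have "mat_adjoint U * (V * ?D) = mat_adjoint U * V * ?D"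
    by (rule assoc_mult_mat[symmetric, of _ n n _ n _ n]) auto
  also have "mat_adjoint U * V * ?D * mat_adjoint V * U = mat_adjoint U * V * ?D * (mat_adjoint V * U)"
    by (rule assoc_mult_mat[of _ n n _ n _ n]) auto
  also have "mat_adjoint V * U = mat_adjoint (mat_adjoint U * V)"
    using mat_adjoint_mult[OF mat_adjoint_carrier[OF U] V] by simp
  finally show ?thesis by (simp add: conj_diag_def)
qed

text \<open>The weights do not depend on \<open>d\<close>: applying a function to the matrix changes
  the numbers that are combined, but not the weights.\<close>

lemma diag_entry_conj_diag:
  assumes U: "U \<in> carrier_mat n n" and V: "V \<in> carrier_mat n n" and j: "j < n"
  shows "diag_entry U (conj_diag n V d) j = (\<Sum>m<n. overlap U V j m * d m)"
proof -
  have "mat_adjoint U * V \<in> carrier_mat n n" using U V by simp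
  then show ?thesis
    unfolding diag_entry_def conj_conj_diag[OF U V] overlap_def cmod_power2
    by (subst index_conj_diag)
       (auto simp: j power2_eq_square algebra_simps sum.distrib)
qed

lemma diag_entry_conj_diag_self:
  assumes U: "unitary_mat n U" and j: "j < n"
  shows "diag_entry U (conj_diag n U d) j = d j"
  unfolding diag_entry_def conj_conj_diag[OF unitary_mat_carrier[OF U] unitary_mat_carrier[OF U]]
    unitary_mat_left[OF U]
  using j by (subst index_conj_diag) (auto simp: if_distrib[of "\<lambda>x. x * _"] cong: if_cong)

text \<open>The double sum is visibly linear in \<open>M\<close>, which is what
  \<open>diag_entry_wsum\<close> exploits.\<close>

lemma diag_entry_sum:
  assumes U: "U \<in> carrier_mat n n" and M: "M \<in> carrier_mat n n" and j: "j < n"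
  shows "diag_entry U M j = (\<Sum>a<n. \<Sum>b<n. Re (cnj (U $$ (a, j)) * M $$ (a, b) * U $$ (b, j)))"
proof -
  have "(mat_adjoint U * M * U) $$ (j, j) = (\<Sum>b<n. (mat_adjoint U * M) $$ (j, b) * U $$ (b, j))"
    using assms by (intro index_mult_mat_sum) auto
  also have "\<dots> = (\<Sum>b<n. \<Sum>a<n. cnj (U $$ (a, j)) * M $$ (a, b) * U $$ (b, j))"
  proof (intro sum.cong refl)
    fix b assume "b \<in> {..<n}"
    then have "(mat_adjoint U * M) $$ (j, b) = (\<Sum>a<n. mat_adjoint U $$ (j, a) * M $$ (a, b))"
      using assms by (intro index_mult_mat_sum) auto
    also have "\<dots> = (\<Sum>a<n. cnj (U $$ (a, j)) * M $$ (a, b))"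
      using j carrier_matD[OF U] by (intro sum.cong refl) simp
    finally show "(mat_adjoint U * M) $$ (j, b) * U $$ (b, j)
        = (\<Sum>a<n. cnj (U $$ (a, j)) * M $$ (a, b) * U $$ (b, j))"
      by (simp add: sum_distrib_right)
  qed
  finally show ?thesis unfolding diag_entry_def by (subst sum.swap) (simp only: Re_sum)
qed

lemma diag_entry_wsum:
  assumes U: "U \<in> carrier_mat n n" and A: "\<And>i. i \<in> {1..k} \<Longrightarrow> A i \<in> carrier_mat n n" and j: "j < n"
  shows "diag_entry U (mat_wsum n k w A) j = (\<Sum>i=1..k. w i * diag_entry U (A i) j)"
proof -
  let ?t = "\<lambda>M a b. Re (cnj (U $$ (a, j)) * M $$ (a, b) * U $$ (b, j))"
  have "mat_wsum n k w A \<in> carrier_mat n n" by (simp add: mat_wsum_def)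
  then have "diag_entry U (mat_wsum n k w A) j = (\<Sum>a<n. \<Sum>b<n. ?t (mat_wsum n k w A) a b)"
    using U j by (intro diag_entry_sum)
  also have "\<dots> = (\<Sum>a<n. \<Sum>b<n. \<Sum>i=1..k. w i * ?t (A i) a b)"
  proof (intro sum.cong refl)
    fix a b assume ab: "a \<in> {..<n}" "b \<in> {..<n}"
    then have "cnj (U $$ (a, j)) * mat_wsum n k w A $$ (a, b) * U $$ (b, j)
        = (\<Sum>i=1..k. of_real (w i) * (cnj (U $$ (a, j)) * A i $$ (a, b) * U $$ (b, j)))"
      by (simp add: mat_wsum_def sum_distrib_left sum_distrib_right mult_ac)
    then show "?t (mat_wsum n k w A) a b = (\<Sum>i=1..k. w i * ?t (A i) a b)"
      by (simp only: Re_sum Re_complex_of_real Im_complex_of_real times_complex.sel) simp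
  qed
  also have "\<dots> = (\<Sum>a<n. \<Sum>i=1..k. \<Sum>b<n. w i * ?t (A i) a b)"
    by (intro sum.cong refl sum.swap)
  also have "\<dots> = (\<Sum>i=1..k. \<Sum>a<n. \<Sum>b<n. w i * ?t (A i) a b)"
    by (rule sum.swap)
  also have "\<dots> = (\<Sum>i=1..k. w i * diag_entry U (A i) j)"
    using diag_entry_sum[OF U A j] by (intro sum.cong refl) (simp add: sum_distrib_left)
  finally show ?thesis .
qed

section \<open>Decreasing rearrangements and sums of largest entries\<close>

lemma sort_desc_permutation:
  obtains \<pi> where "bij_betw \<pi> {..<n} {..<n}"
    "\<And>i. i < n \<Longrightarrow> rev (sort (map d [0..<n])) ! i = d (\<pi> i)"
proof -
  let ?xs = "rev (sort (map d [0..<n]))"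
  have "mset ?xs = mset (map d [0..<n])" by simp
  then obtain p where p: "p permutes {..<length (map d [0..<n])}" "permute_list p (map d [0..<n]) = ?xs"
    by (rule mset_eq_permutation)
  have p': "p permutes {..<n}" using p(1) by simp
  show thesis
  proof (rule that)
    show "bij_betw p {..<n} {..<n}" using p' by (rule permutes_imp_bij)
    fix i assume i: "i < n"
    have "p i < n" using permutes_in_image[OF p', of i] i by simp
    then show "?xs ! i = d (p i)" unfolding p(2)[symmetric] using i p(1) by (simp add: permute_list_nth)
  qed
qed

text \<open>A total weight of \<open>l\<close>, with at most 1 on each entry, is best spent by
  putting weight 1 on the \<open>l\<close> largest entries.\<close>

lemma sum_weights_le_sum_top:
  fixes c p :: "nat \<Rightarrow> real"
  assumes "l \<le> n" and desc: "\<And>i j. i \<le> j \<Longrightarrow> j < n \<Longrightarrow> c j \<le> c i"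
    and p: "\<And>m. m < n \<Longrightarrow> 0 \<le> p m" "\<And>m. m < n \<Longrightarrow> p m \<le> 1" and "(\<Sum>m<n. p m) = real l"
  shows "(\<Sum>m<n. p m * c m) \<le> (\<Sum>m<l. c m)"
proof (cases l)
  case 0
  then have "p m = 0" if "m < n" for m
    using that assms(5) p(1) sum_nonneg_eq_0_iff[of "{..<n}" p] by simp
  then show ?thesis using 0 by simp
next
  case (Suc l')
  \<comment> \<open>The threshold is the smallest of the \<open>l\<close> largest entries, at
    position \<open>l - 1\<close>. Entries before \<open>l\<close> are at least \<open>t\<close> and
    profit from weight 1, the others are at most \<open>t\<close> and profit from weight 0. Since
    the weights sum to \<open>l\<close>, subtracting \<open>t\<close> changes both sides by the same
    amount \<open>l * t\<close>.\<close>
  define t where "t = c l'"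
  have "(\<Sum>m<n. p m * (c m - t)) \<le> (\<Sum>m<n. if m < l then c m - t else 0)"
  proof (rule sum_mono)
    fix m assume "m \<in> {..<n}"
    then have m: "m < n" by simp
    show "p m * (c m - t) \<le> (if m < l then c m - t else 0)"
    proof (cases "m < l")
      case True
      then have "t \<le> c m" unfolding t_def using Suc assms(1) by (intro desc) auto
      then show ?thesis using True p[OF m] mult_right_mono[of "p m" 1 "c m - t"] by simp
    next
      case False
      then have "c m \<le> t" unfolding t_def using Suc m by (intro desc) auto
      then show ?thesis using False p(1)[OF m] by (simp add: mult_nonneg_nonpos)
    qed
  qed
  also have "(\<Sum>m<n. if m < l then c m - t else 0) = (\<Sum>m<l. c m - t)"
    using assms(1) by (intro sum.mono_neutral_cong_right) auto
  finally show ?thesis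
    using assms(5) by (simp add: right_diff_distrib sum_subtractf flip: sum_distrib_right)
qed

text \<open>The diagonal of \<open>V diag(c) V\<^sup>*\<close> in an orthonormal basis \<open>U\<close>
  is the image of \<open>c\<close> under a doubly stochastic matrix.\<close>

lemma weak_majorized_conj_diag:
  assumes U: "unitary_mat n U" and V: "unitary_mat n V"
    and le: "\<And>j. j < n \<Longrightarrow> d j \<le> diag_entry U (conj_diag n V c) j"
  shows "eigvals_desc (conj_diag n U d) \<prec>\<^sub>w eigvals_desc (conj_diag n V c)"
  unfolding eigvals_desc_conj_diag[OF U] eigvals_desc_conj_diag[OF V] weak_majorized_def
proof (intro conjI ballI)
  let ?xs = "rev (sort (map d [0..<n]))" and ?ys = "rev (sort (map c [0..<n]))"
  show "length ?xs = length ?ys" by simp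
  fix l assume "l \<in> {1..length ?xs}"
  then have l: "l \<le> n" by simp
  \<comment> \<open>Sorting is traded for permutations: the partial sums then run over the
    eigenvalues at \<open>l\<close> distinct columns.\<close>
  obtain \<pi> where \<pi>: "bij_betw \<pi> {..<n} {..<n}" "\<And>i. i < n \<Longrightarrow> ?xs ! i = d (\<pi> i)"
    using sort_desc_permutation[of n d] by metis
  obtain \<rho> where \<rho>: "bij_betw \<rho> {..<n} {..<n}" "\<And>i. i < n \<Longrightarrow> ?ys ! i = c (\<rho> i)"
    using sort_desc_permutation[of n c] by metis
  have \<pi>n: "\<pi> i < n" if "i < n" for i using bij_betwE[OF \<pi>(1)] that by auto
  have \<rho>n: "\<rho> i < n" if "i < n" for i using bij_betwE[OF \<rho>(1)] that by auto
  have desc: "?ys ! j \<le> ?ys ! i" if "i \<le> j" "j < n" for i j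
    using that by (simp add: rev_nth sorted_nth_mono)
  \<comment> \<open>The total weight with which \<open>c m\<close> enters the quadratic forms
    belonging to the \<open>l\<close> largest entries of \<open>d\<close>. Column sums of the doubly
    stochastic matrix bound it by 1, and row sums make the total equal to \<open>l\<close>.\<close>
  define p where "p m = (\<Sum>j<l. overlap U V (\<pi> j) m)" for m
  have "(\<Sum>j<l. ?xs ! j) = (\<Sum>j<l. d (\<pi> j))"
    using l by (intro sum.cong refl \<pi>(2)) auto
  also have "\<dots> \<le> (\<Sum>j<l. \<Sum>m<n. overlap U V (\<pi> j) m * c m)"
  proof (rule sum_mono)
    fix j assume "j \<in> {..<l}"
    then have "\<pi> j < n" using \<pi>n l by simp
    then show "d (\<pi> j) \<le> (\<Sum>m<n. overlap U V (\<pi> j) m * c m)"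
      using le diag_entry_conj_diag[OF unitary_mat_carrier[OF U] unitary_mat_carrier[OF V]] by metis
  qed
  also have "\<dots> = (\<Sum>m<n. p m * c m)"
    unfolding p_def sum_distrib_right by (rule sum.swap)
  \<comment> \<open>Reindexing by \<rho> lists the values of \<open>c\<close> in decreasing
    order.\<close>
  also have "\<dots> = (\<Sum>m<n. p (\<rho> m) * ?ys ! m)"
    using \<rho>(2) by (subst sum.reindex_bij_betw[OF \<rho>(1), symmetric]) (auto intro: sum.cong)
  also have "\<dots> \<le> (\<Sum>m<l. ?ys ! m)"
  proof (rule sum_weights_le_sum_top[OF l desc])
    fix m assume m: "m < n"
    show "0 \<le> p (\<rho> m)" unfolding p_def by (intro sum_nonneg overlap_nonneg)
    have "p (\<rho> m) \<le> (\<Sum>j<n. overlap U V (\<pi> j) (\<rho> m))"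
      unfolding p_def using l by (intro sum_mono2) (auto simp: overlap_nonneg)
    also have "\<dots> = (\<Sum>j<n. overlap U V j (\<rho> m))"
      by (rule sum.reindex_bij_betw[OF \<pi>(1)])
    also have "\<dots> = 1" using overlap_col_sum[OF U V \<rho>n[OF m]] .
    finally show "p (\<rho> m) \<le> 1" .
  next
    have "(\<Sum>m<n. p (\<rho> m)) = (\<Sum>m<n. p m)" by (rule sum.reindex_bij_betw[OF \<rho>(1)])
    also have "\<dots> = (\<Sum>j<l. \<Sum>m<n. overlap U V (\<pi> j) m)" unfolding p_def by (rule sum.swap)
    also have "\<dots> = (\<Sum>j<l. 1)" using \<pi>n l by (intro sum.cong refl overlap_row_sum[OF U V]) auto
    finally show "(\<Sum>m<n. p (\<rho> m)) = real l" by simp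
  qed
  finally show "(\<Sum>j<l. ?xs ! j) \<le> (\<Sum>j<l. ?ys ! j)" .
qed

section \<open>Convexity of the scalar functions\<close>

text \<open>Between \<open>x\<close> and \<open>y\<close> the graph of \<open>h\<close> lies below
  the chord. Taking absolute values makes the bound independent of the side of \<open>x\<close> on
  which \<open>y\<close> lies. If \<open>x = y\<close>, then \<open>u = x\<close> as well.\<close>

lemma convex_on_chord_bound:
  fixes h :: "real \<Rightarrow> real"
  assumes h: "convex_on S h" and "x \<in> S" "y \<in> S" and u: "u \<in> closed_segment x y"
  shows "h u \<le> h x + \<bar>h y - h x\<bar> / \<bar>y - x\<bar> * \<bar>u - x\<bar>"
proof (cases "x = y")
  case False
  from u obtain t where t: "0 \<le> t" "t \<le> 1" "u = (1 - t) *\<^sub>R x + t *\<^sub>R y"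
    by (auto simp: closed_segment_def)
  have "u - x = t * (y - x)" using t(3) by (simp add: algebra_simps)
  then have tu: "t * \<bar>y - x\<bar> = \<bar>u - x\<bar>" using t(1) by (simp add: abs_mult)
  have "h u \<le> (1 - t) * h x + t * h y"
    unfolding t(3) using convex_onD[OF h t(1,2) assms(2,3)] .
  also have "\<dots> = h x + t * (h y - h x)" by (simp add: algebra_simps)
  also have "\<dots> \<le> h x + t * \<bar>h y - h x\<bar>" using t(1) by (simp add: mult_left_mono)
  also have "t * \<bar>h y - h x\<bar> = \<bar>h y - h x\<bar> / \<bar>y - x\<bar> * \<bar>u - x\<bar>"
    unfolding tu[symmetric] using False by simp
  finally show ?thesis .
qed (use u in auto)

lemma convex_on_upper_bound_at:
  fixes h :: "real \<Rightarrow> real"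
  assumes h: "convex_on {a..b} h" and x: "x \<in> {a..b}"
  obtains K where "\<And>u. u \<in> {a..b} \<Longrightarrow> h u \<le> h x + K * \<bar>u - x\<bar>"
proof
  \<comment> \<open>The absolute slopes of the chords from \<open>x\<close> to the two endpoints.
    Both are nonnegative, so their sum serves on either side of \<open>x\<close>. If
    \<open>x\<close> is itself an endpoint, one quotient is 0 by the convention for division by
    0.\<close>
  let ?q = "\<lambda>y. \<bar>h y - h x\<bar> / \<bar>y - x\<bar>"
  fix u assume u: "u \<in> {a..b}"
  then have "u \<in> closed_segment x a \<or> u \<in> closed_segment x b"
    using x by (auto simp: closed_segment_eq_real_ivl)
  then obtain y where y: "y \<in> {a, b}" "u \<in> closed_segment x y" by blast
  then have "h u \<le> h x + ?q y * \<bar>u - x\<bar>"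
    using x by (intro convex_on_chord_bound[OF h]) auto
  also have "?q y * \<bar>u - x\<bar> \<le> (?q a + ?q b) * \<bar>u - x\<bar>"
    using y(1) by (intro mult_right_mono) auto
  finally show "h u \<le> h x + (?q a + ?q b) * \<bar>u - x\<bar>" by simp
qed

text \<open>On a compact interval a convex function is upper semicontinuous and a concave one is lower
  semicontinuous, endpoints included; so \<open>g \<circ> f\<close> is continuous although \<open>g\<close> itself may jump at
  the left end of its domain.\<close>

lemma continuous_on_convex_comp_concave:
  fixes f g :: "real \<Rightarrow> real"
  assumes ab: "a \<le> b" and f: "continuous_on {a..b} f" and fS: "f ` {a..b} \<subseteq> S"
    and g: "concave_on S g" and h: "convex_on {a..b} (g \<circ> f)"
  shows "continuous_on {a..b} (g \<circ> f)"
proof -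
  \<comment> \<open>The range of \<open>f\<close> is a compact interval, so the chord bound applies
    to the convex \<open>- g\<close> there, even when \<open>f x\<close> is an endpoint of that
    range.\<close>
  obtain c d where cd: "f ` {a..b} = {c..d}"
    using continuous_image_closed_interval[OF ab f] by blast
  have g': "convex_on {c..d} (\<lambda>x. - g x)"
    using convex_on_subset[of S "\<lambda>x. - g x" "{c..d}"] g fS cd by (simp add: concave_on_def)
  have "((g \<circ> f) \<longlongrightarrow> (g \<circ> f) x) (at x within {a..b})" if x: "x \<in> {a..b}" for x
  proof -
    from x cd have fx: "f x \<in> {c..d}" by blast
    obtain K where K: "\<And>u. u \<in> {a..b} \<Longrightarrow> (g \<circ> f) u \<le> (g \<circ> f) x + K * \<bar>u - x\<bar>"
      using convex_on_upper_bound_at[OF h x] by metis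
    obtain L where L: "\<And>v. v \<in> {c..d} \<Longrightarrow> - g v \<le> - g (f x) + L * \<bar>v - f x\<bar>"
      using convex_on_upper_bound_at[OF g' fx] by metis
    have fx': "(f \<longlongrightarrow> f x) (at x within {a..b})"
      using f x by (simp add: continuous_on_def)
    show ?thesis
    proof (rule tendsto_sandwich)
      show "\<forall>\<^sub>F u in at x within {a..b}. (g \<circ> f) x - L * \<bar>f u - f x\<bar> \<le> (g \<circ> f) u"
        unfolding eventually_at_filter
        by (rule always_eventually) (use L cd in \<open>fastforce simp: o_def\<close>)
      show "\<forall>\<^sub>F u in at x within {a..b}. (g \<circ> f) u \<le> (g \<circ> f) x + K * \<bar>u - x\<bar>"
        unfolding eventually_at_filter by (rule always_eventually) (use K in blast)
      show "((\<lambda>u. (g \<circ> f) x - L * \<bar>f u - f x\<bar>) \<longlongrightarrow> (g \<circ> f) x) (at x within {a..b})"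
        using fx' by (auto intro!: tendsto_eq_intros)
      show "((\<lambda>u. (g \<circ> f) x + K * \<bar>u - x\<bar>) \<longlongrightarrow> (g \<circ> f) x) (at x within {a..b})"
        by (auto intro!: tendsto_eq_intros)
    qed
  qed
  then show ?thesis unfolding continuous_on_def by blast
qed

text \<open>The intermediate value theorem for \<open>g \<circ> f\<close> on compact subintervals of
  \<open>J\<close>. It keeps averages of values of \<open>g \<circ> f\<close> inside the domain of
  the inverse of \<open>g\<close>; the image of \<open>J\<^sub>2\<close> under \<open>g\<close> can
  have a gap, since \<open>g\<close> may jump at a left endpoint.\<close>

lemma convex_image_g_convex:
  assumes J: "is_interval J" and gc: "g_convex J J\<^sub>2 J\<^sub>3 g f"
  shows "convex ((g \<circ> f) ` J)"
proof -
  have "y \<in> (g \<circ> f) ` J" if ab: "a \<in> J" "b \<in> J" and y: "(g \<circ> f) a \<le> y" "y \<le> (g \<circ> f) b" for a b y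
  proof -
    \<comment> \<open>The points \<open>a\<close> and \<open>b\<close> are ordered by their values
      under \<open>g \<circ> f\<close>, so either one may be the left one.\<close>
    let ?l = "min a b" and ?u = "max a b"
    have lu: "?l \<in> J" "?u \<in> J" using ab by (auto simp: min_def max_def)
    have sub: "{?l..?u} \<subseteq> J" using J lu unfolding is_interval_1 by (meson atLeastAtMost_iff subsetI)
    have "continuous_on {?l..?u} (g \<circ> f)"
    proof (rule continuous_on_convex_comp_concave[of _ _ _ J\<^sub>2])
      show "continuous_on {?l..?u} f" "f ` {?l..?u} \<subseteq> J\<^sub>2" "concave_on J\<^sub>2 g"
        using gc sub unfolding g_convex_def by (auto intro: continuous_on_subset)
      show "convex_on {?l..?u} (g \<circ> f)"
        using gc sub unfolding g_convex_def by (auto intro: convex_on_subset)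
    qed simp
    then have "connected ((g \<circ> f) ` {?l..?u})" by (rule connected_continuous_image) simp
    then have "is_interval ((g \<circ> f) ` {?l..?u})" by (simp add: is_interval_connected_1)
    moreover have "(g \<circ> f) a \<in> (g \<circ> f) ` {?l..?u}" "(g \<circ> f) b \<in> (g \<circ> f) ` {?l..?u}" by auto
    ultimately have "y \<in> (g \<circ> f) ` {?l..?u}" using y unfolding is_interval_1 by blast
    then show ?thesis using sub by blast
  qed
  then have "is_interval ((g \<circ> f) ` J)" unfolding is_interval_1 by blast
  then show ?thesis by (rule is_interval_convex)
qed

section \<open>The inverse of \<open>g\<close>\<close>

lemma inv_into_comp:
  fixes g :: "real \<Rightarrow> real"
  assumes "g_convex J J\<^sub>2 J\<^sub>3 g f" "x \<in> J"
  shows "inv_into J\<^sub>2 g ((g \<circ> f) x) = f x"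
  using assms unfolding g_convex_def
  by (auto intro!: inv_into_f_f strict_mono_on_imp_inj_on)

text \<open>Monotonicity of the inverse, phrased with a point \<open>z\<close> of \<open>S\<close>
  because in its uses \<open>g z\<close> may lie outside the set on which the inverse is known to be
  convex.\<close>

lemma inv_into_le:
  fixes g :: "real \<Rightarrow> real"
  assumes g: "strict_mono_on S g" and y: "y \<in> g ` S" and z: "z \<in> S" and le: "y \<le> g z"
  shows "inv_into S g y \<le> z"
proof (rule ccontr)
  assume "\<not> inv_into S g y \<le> z"
  then have "g z < g (inv_into S g y)"
    using z inv_into_into[OF y] by (intro strict_mono_onD[OF g]) auto
  then show False using le f_inv_into_f[OF y] by simp
qed

text \<open>Apply the increasing inverse to the concavity inequality of \<open>g\<close> at the
  preimages of \<open>u\<close> and \<open>v\<close>. The restriction to a convex \<open>H\<close>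
  is made because the full image of \<open>S\<close> may fail to be convex.\<close>

lemma convex_on_inv_into:
  fixes g :: "real \<Rightarrow> real"
  assumes g: "strict_mono_on S g" "concave_on S g" and H: "convex H" "H \<subseteq> g ` S"
  shows "convex_on H (inv_into S g)"
proof (rule convex_onI)
  fix t u v :: real assume t: "0 < t" "t < 1" and uv: "u \<in> H" "v \<in> H"
  let ?i = "inv_into S g"
  have iS: "?i u \<in> S" "?i v \<in> S" using uv H(2) by (auto intro: inv_into_into)
  have gi: "g (?i u) = u" "g (?i v) = v" using uv H(2) by (auto intro: f_inv_into_f)
  have S: "convex S" using g(2) by (rule concave_on_imp_convex)
  have "(1 - t) *\<^sub>R u + t *\<^sub>R v \<in> H" using uv t by (intro convexD[OF H(1)]) auto
  moreover have "(1 - t) *\<^sub>R ?i u + t *\<^sub>R ?i v \<in> S" using iS t by (intro convexD[OF S]) auto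
  moreover have "(1 - t) *\<^sub>R u + t *\<^sub>R v \<le> g ((1 - t) *\<^sub>R ?i u + t *\<^sub>R ?i v)"
    using concave_onD[OF g(2) _ _ iS, of t] t gi by simp
  ultimately have "?i ((1 - t) *\<^sub>R u + t *\<^sub>R v) \<le> (1 - t) *\<^sub>R ?i u + t *\<^sub>R ?i v"
    using H(2) by (intro inv_into_le[OF g(1)]) auto
  then show "?i ((1 - t) *\<^sub>R u + t *\<^sub>R v) \<le> (1 - t) * ?i u + t * ?i v" by simp
qed (rule H(1))

section \<open>The two majorizations\<close>

text \<open>An index \<open>t\<close> is a pair of a matrix \<open>A i\<close> and one of its
  eigenvectors; \<open>x t\<close> is the eigenvalue and \<open>q t\<close> is \<open>w i\<close>
  times the overlap of that eigenvector with column \<open>j\<close> of \<open>U\<close>. The same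
  \<open>q\<close> and \<open>x\<close> serve for every \<phi>, which lets scalar inequalities be
  transferred.\<close>

lemma diag_entry_wsum_mat_fun:
  assumes A: "\<forall>i\<in>{1..k}. hermitian_mat n (A i)"
    and J: "\<forall>i\<in>{1..k}. spectrum (A i) \<subseteq> complex_of_real ` J"
    and w: "\<forall>i\<in>{1..k}. w i \<ge> 0" "(\<Sum>i=1..k. w i) = 1"
    and U: "unitary_mat n U" and j: "j < n"
  obtains T :: "(nat \<times> nat) set" and q x where "finite T" "T \<noteq> {}" "(\<Sum>t\<in>T. q t) = 1"
    "\<And>t. t \<in> T \<Longrightarrow> q t \<ge> 0" "\<And>t. t \<in> T \<Longrightarrow> x t \<in> J"
    "\<And>\<phi>. diag_entry U (mat_wsum n k w (\<lambda>i. mat_fun \<phi> (A i))) j = (\<Sum>t\<in>T. q t * \<phi> (x t))"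
    "diag_entry U (mat_wsum n k w A) j = (\<Sum>t\<in>T. q t * x t)"
proof -
  have "\<forall>i\<in>{1..k}. \<exists>V d. unitary_mat n V \<and> A i = conj_diag n V d"
    using A hermitian_mat_diagonalize by metis
  then obtain V d where V: "\<And>i. i \<in> {1..k} \<Longrightarrow> unitary_mat n (V i)"
    and Ai: "\<And>i. i \<in> {1..k} \<Longrightarrow> A i = conj_diag n (V i) (d i)"
    by metis
  define T where "T = {1..k} \<times> {..<n}"
  define q where "q t = w (fst t) * overlap U (V (fst t)) j (snd t)" for t
  define x where "x t = d (fst t) (snd t)" for t
  have sumT: "(\<Sum>t\<in>T. q t * \<phi> (x t)) = (\<Sum>i=1..k. w i * (\<Sum>m<n. overlap U (V i) j m * \<phi> (d i m)))" for \<phi>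
    unfolding T_def q_def x_def sum_distrib_left
    by (simp add: sum.cartesian_product case_prod_unfold mult.assoc)
  \<comment> \<open>Stated for general \<open>B\<close> so that it covers both the matrices
    \<open>mat_fun \<phi> (A i)\<close> and, with the identity for \<phi>, the matrices
    \<open>A i\<close> themselves.\<close>
  have entry: "diag_entry U (mat_wsum n k w B) j = (\<Sum>t\<in>T. q t * \<phi> (x t))"
    if B: "\<And>i. i \<in> {1..k} \<Longrightarrow> B i = conj_diag n (V i) (\<lambda>m. \<phi> (d i m))" for B \<phi>
  proof -
    have "diag_entry U (mat_wsum n k w B) j = (\<Sum>i=1..k. w i * diag_entry U (B i) j)"
      using B V j unitary_mat_carrier by (intro diag_entry_wsum) (auto intro: unitary_mat_carrier[OF U])
    also have "\<dots> = (\<Sum>i=1..k. w i * (\<Sum>m<n. overlap U (V i) j m * \<phi> (d i m)))"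
      by (intro sum.cong refl) (simp add: B diag_entry_conj_diag[OF unitary_mat_carrier[OF U] unitary_mat_carrier[OF V] j])
    finally show ?thesis unfolding sumT .
  qed
  show thesis
  proof (rule that)
    show "finite T" by (simp add: T_def)
    show "(\<Sum>t\<in>T. q t) = 1"
      using sumT[of "\<lambda>_. 1"] w(2) by (simp add: overlap_row_sum[OF U V j])
    then show "T \<noteq> {}" by auto
    show "q t \<ge> 0" if "t \<in> T" for t
      using that w(1) unfolding q_def T_def by (auto intro!: mult_nonneg_nonneg overlap_nonneg)
    show "x t \<in> J" if "t \<in> T" for t
    proof -
      from that have i: "fst t \<in> {1..k}" "snd t < n" by (auto simp: T_def)
      then have "complex_of_real (x t) \<in> spectrum (A (fst t))"
        unfolding Ai[OF i(1)] spectrum_conj_diag[OF V[OF i(1)]] x_def by blast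
      then show ?thesis using bspec[OF J i(1)] by auto
    qed
    show "diag_entry U (mat_wsum n k w (\<lambda>i. mat_fun \<phi> (A i))) j = (\<Sum>t\<in>T. q t * \<phi> (x t))" for \<phi>
      by (intro entry) (simp add: Ai mat_fun_conj_diag[OF V])
    show "diag_entry U (mat_wsum n k w A) j = (\<Sum>t\<in>T. q t * x t)"
      using entry[of A "\<lambda>x. x"] Ai by simp
  qed
qed

theorem theorem4p2:
  fixes n k :: nat
    and A :: "nat \<Rightarrow> complex mat"
    and w :: "nat \<Rightarrow> real"
    and f g :: "real \<Rightarrow> real"
    and J J\<^sub>2 J\<^sub>3 :: "real set"
  assumes "n \<ge> 1"
    and "is_interval J" "is_interval J\<^sub>2" "is_interval J\<^sub>3"
    and "\<And>i. i \<in> {1..k} \<Longrightarrow> hermitian_mat n (A i)"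
    and "\<And>i. i \<in> {1..k} \<Longrightarrow> spectrum (A i) \<subseteq> complex_of_real ` J"
    and "g_convex J J\<^sub>2 J\<^sub>3 g f"
    and "\<And>i. i \<in> {1..k} \<Longrightarrow> w i > 0"
    and "(\<Sum>i=1..k. w i) = 1"
  shows "eigvals_desc (mat_fun f (mat_wsum n k w A))
           \<prec>\<^sub>w eigvals_desc (mat_fun (inv_into J\<^sub>2 g) (mat_wsum n k w (\<lambda>i. mat_fun (g \<circ> f) (A i))))
       \<and> eigvals_desc (mat_fun (inv_into J\<^sub>2 g) (mat_wsum n k w (\<lambda>i. mat_fun (g \<circ> f) (A i))))
           \<prec>\<^sub>w eigvals_desc (mat_wsum n k w (\<lambda>i. mat_fun f (A i)))"
proof -
  define h where "h = g \<circ> f"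
  define gi where "gi = inv_into J\<^sub>2 g"
  define H where "H = h ` J"
  define B where "B = mat_wsum n k w (\<lambda>i. mat_fun h (A i))"
  define C where "C = mat_wsum n k w (\<lambda>i. mat_fun f (A i))"
  have gc: "f ` J \<subseteq> J\<^sub>2" "strict_mono_on J\<^sub>2 g" "concave_on J\<^sub>2 g" "convex_on J h"
    using assms(7) by (auto simp: g_convex_def h_def)
  have H: "convex H" unfolding H_def h_def by (rule convex_image_g_convex[OF assms(2,7)])
  have HJ: "H \<subseteq> g ` J\<^sub>2" using gc(1) by (auto simp: H_def h_def)
  have gih: "gi (h x) = f x" if "x \<in> J" for x
    unfolding gi_def h_def by (rule inv_into_comp[OF assms(7) that])
  have gi_convex: "convex_on H gi" unfolding gi_def by (rule convex_on_inv_into[OF gc(2,3) H HJ])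
  have gi_le: "gi y \<le> z" if "y \<in> H" "z \<in> J\<^sub>2" "y \<le> g z" for y z
    unfolding gi_def using that HJ by (intro inv_into_le[OF gc(2)]) auto
  have "\<forall>i\<in>{1..k}. hermitian_mat n (A i)" "\<forall>i\<in>{1..k}. spectrum (A i) \<subseteq> complex_of_real ` J"
    "\<forall>i\<in>{1..k}. w i \<ge> 0"
    using assms(5,6,8) by (auto intro: less_imp_le)
  note weights = diag_entry_wsum_mat_fun[OF this assms(9)]

  have herm_fun: "hermitian_mat n (mat_fun \<phi> (A i))" if i: "i \<in> {1..k}" for \<phi> i
  proof (rule hermitian_mat_diagonalize[OF assms(5)[OF i]])
    fix U d assume "unitary_mat n U" "A i = conj_diag n U d"
    then show ?thesis by (simp add: mat_fun_conj_diag hermitian_conj_diag unitary_mat_carrier)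
  qed
  \<comment> \<open>Eigenbases of the three weighted sums. The first majorization is tested on the
    columns of \<open>U\<close>, the second on those of \<open>V\<close>.\<close>
  have "hermitian_mat n (mat_wsum n k w A)" using assms(5) by (rule hermitian_mat_wsum)
  then obtain U \<alpha> where U: "unitary_mat n U" and A: "mat_wsum n k w A = conj_diag n U \<alpha>"
    by (rule hermitian_mat_diagonalize)
  have "hermitian_mat n B" unfolding B_def using herm_fun by (rule hermitian_mat_wsum)
  then obtain V \<beta> where V: "unitary_mat n V" and B: "B = conj_diag n V \<beta>"
    by (rule hermitian_mat_diagonalize)
  have "hermitian_mat n C" unfolding C_def using herm_fun by (rule hermitian_mat_wsum)
  then obtain W \<gamma> where W: "unitary_mat n W" and C: "C = conj_diag n W \<gamma>"
    by (rule hermitian_mat_diagonalize)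

  \<comment> \<open>These values are averages of values of \<open>h\<close>, hence lie in the convex
    set \<open>H\<close>. Taking \<open>X = V\<close> yields the same for the eigenvalues \<beta> of
    \<open>B\<close>.\<close>
  have BH: "diag_entry X B j \<in> H" if X: "unitary_mat n X" and j: "j < n" for X j
  proof (rule weights[OF X j])
    fix T :: "(nat \<times> nat) set" and q x assume T: "finite T" "T \<noteq> {}" "sum q T = 1" "\<And>t. t \<in> T \<Longrightarrow> q t \<ge> 0" "\<And>t. t \<in> T \<Longrightarrow> x t \<in> J"
      and e: "\<And>\<phi>. diag_entry X (mat_wsum n k w (\<lambda>i. mat_fun \<phi> (A i))) j = (\<Sum>t\<in>T. q t * \<phi> (x t))"
    show "diag_entry X B j \<in> H"
      using convex_sum[OF T(1) H T(3,4), of "\<lambda>t. h (x t)"] T(5) by (simp add: B_def e H_def)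
  qed
  have \<beta>H: "\<beta> j \<in> H" if "j < n" for j
    using BH[OF V that] diag_entry_conj_diag_self[OF V that] by (simp add: B)

  have "eigvals_desc (conj_diag n U (\<lambda>i. f (\<alpha> i))) \<prec>\<^sub>w eigvals_desc (conj_diag n V (\<lambda>i. gi (\<beta> i)))"
  proof (rule weak_majorized_conj_diag[OF U V])
    fix j assume j: "j < n"
    show "f (\<alpha> j) \<le> diag_entry U (conj_diag n V (\<lambda>i. gi (\<beta> i))) j"
    proof (rule weights[OF U j])
      fix T :: "(nat \<times> nat) set" and q x assume T: "finite T" "T \<noteq> {}" "sum q T = 1" "\<And>t. t \<in> T \<Longrightarrow> q t \<ge> 0" "\<And>t. t \<in> T \<Longrightarrow> x t \<in> J"
        and e: "\<And>\<phi>. diag_entry U (mat_wsum n k w (\<lambda>i. mat_fun \<phi> (A i))) j = (\<Sum>t\<in>T. q t * \<phi> (x t))"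
        and eA: "diag_entry U (mat_wsum n k w A) j = (\<Sum>t\<in>T. q t * x t)"
      \<comment> \<open>An eigenvalue is the value of the quadratic form at its own eigenvector,
        hence an average of the points \<open>x t\<close> of the interval \<open>J\<close>.\<close>
      have \<alpha>: "\<alpha> j = (\<Sum>t\<in>T. q t * x t)"
        using eA diag_entry_conj_diag_self[OF U j] by (simp add: A)
      have \<alpha>J: "\<alpha> j \<in> J"
        using convex_sum[OF T(1) is_interval_convex[OF assms(2)] T(3,4,5)] by (simp add: \<alpha>)
      \<comment> \<open>Jensen's inequality for the convex \<open>h\<close> at the points
        \<open>x t\<close>. The increasing \<open>gi\<close> is applied to it next, turning
        \<open>h (\<alpha> j)\<close> into \<open>f (\<alpha> j)\<close>.\<close>
      have "h (\<alpha> j) \<le> diag_entry U B j"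
        using convex_on_sum[OF T(1,2) gc(4) T(3,4,5)] by (simp add: \<alpha> B_def e)
      also have "\<dots> = g (gi (diag_entry U B j))"
        unfolding gi_def using BH[OF U j] HJ by (intro f_inv_into_f[symmetric]) auto
      finally have "gi (h (\<alpha> j)) \<le> gi (diag_entry U B j)"
        using BH[OF U j] HJ \<alpha>J by (intro gi_le) (auto simp: H_def gi_def intro!: inv_into_into)
      also have "\<dots> = gi (\<Sum>m<n. overlap U V j m * \<beta> m)"
        unfolding B by (simp add: diag_entry_conj_diag[OF unitary_mat_carrier[OF U] unitary_mat_carrier[OF V] j])
      \<comment> \<open>Jensen's inequality again, now for the convex \<open>gi\<close> at the
        eigenvalues of \<open>B\<close>, weighted by the overlaps with column \<open>j\<close> of
        \<open>U\<close>.\<close>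
      also have "\<dots> \<le> (\<Sum>m<n. overlap U V j m * gi (\<beta> m))"
        using convex_on_sum[OF _ _ gi_convex overlap_row_sum[OF U V j], of \<beta>] \<beta>H j overlap_nonneg by auto
      also have "\<dots> = diag_entry U (conj_diag n V (\<lambda>i. gi (\<beta> i))) j"
        by (simp add: diag_entry_conj_diag[OF unitary_mat_carrier[OF U] unitary_mat_carrier[OF V] j])
      finally show ?thesis using gih[OF \<alpha>J] by simp
    qed
  qed
  moreover have "eigvals_desc (conj_diag n V (\<lambda>i. gi (\<beta> i))) \<prec>\<^sub>w eigvals_desc (conj_diag n W \<gamma>)"
  proof (rule weak_majorized_conj_diag[OF V W])
    fix j assume j: "j < n"
    show "gi (\<beta> j) \<le> diag_entry V (conj_diag n W \<gamma>) j"
    proof (rule weights[OF V j])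
      fix T :: "(nat \<times> nat) set" and q x assume T: "finite T" "T \<noteq> {}" "sum q T = 1" "\<And>t. t \<in> T \<Longrightarrow> q t \<ge> 0" "\<And>t. t \<in> T \<Longrightarrow> x t \<in> J"
        and e: "\<And>\<phi>. diag_entry V (mat_wsum n k w (\<lambda>i. mat_fun \<phi> (A i))) j = (\<Sum>t\<in>T. q t * \<phi> (x t))"
      have fJ: "f (x t) \<in> J\<^sub>2" if "t \<in> T" for t using T(5)[OF that] gc(1) by auto
      \<comment> \<open>The identity \<open>e\<close> is used for \<open>h\<close> here and for
        \<open>f\<close> at the end, so one family of weights links \<open>B\<close> and
        \<open>C\<close>. In between stands Jensen's inequality for the concave \<open>g\<close> at
        the points \<open>f (x t)\<close>.\<close>
      have "\<beta> j = (\<Sum>t\<in>T. q t * g (f (x t)))"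
        using e[of h] diag_entry_conj_diag_self[OF V j, of \<beta>] unfolding B[symmetric] B_def by (simp add: h_def)
      also have "\<dots> \<le> g (\<Sum>t\<in>T. q t * f (x t))"
        using concave_on_sum[OF T(1,2) gc(3) T(3,4), of "\<lambda>t. f (x t)"] fJ by simp
      finally have "gi (\<beta> j) \<le> (\<Sum>t\<in>T. q t * f (x t))"
        using convex_sum[OF T(1) concave_on_imp_convex[OF gc(3)] T(3,4), of "\<lambda>t. f (x t)"] fJ \<beta>H[OF j]
        by (intro gi_le) auto
      then show ?thesis by (simp add: C[symmetric] C_def e)
    qed
  qed
  ultimately show ?thesis
    unfolding A gi_def[symmetric] h_def[symmetric] B_def[symmetric] C_def[symmetric]
    unfolding B C mat_fun_conj_diag[OF U] mat_fun_conj_diag[OF V] by blast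
qed

end
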